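(* Let $S$ be a $\mathrm{Cu}$-semigroup satisfying (O5), (O6) and (O7), let $I$ be an ideal in $S$, and let $m_1,m_2\in\mathbb{N}$. Assume that $S/I$ has $m_1$-comparison and that $I$ has $m_2$-comparison. Then $S$ has $(m_1+m_2+1)$-comparison.
   Context: A $\mathrm{Cu}$-semigroup is a positively ordered (commutative) monoid $S$ (partial order compatible with addition, $0\leq x$ for all $x$) such that: (O1) increasing sequences have suprema; (O2) every element is the supremum of a sequence $(x_n)_n$ with $x_n\ll x_{n+1}$; (O3) $x'\ll x$ and $y'\ll y$ imply $x'+y'\ll x+y$; (O4) $\sup_n(x_n+y_n)=\sup_n x_n+\sup_n y_n$ for increasing sequences. Here $x\ll y$ means: for every increasing sequence $(y_n)_n$ with $y\leq\sup_n y_n$ there is $n$ with $x\leq y_n$. Additional axioms: (O5) for all $r',r,s',s,t\in S$ with $r+s\leq t$, $r'\ll r$, $s'\ll s$ there is $u\in S$ with $r'+u\leq t\leq r+u$ and $s'\ll u$. (O6) for all $x',x,y,z$ with $x'\ll x\leq y+z$ there are $e,f$ with $x'\leq e+f$, $e\leq x,y$ and $f\leq x,z$. (O7) for all $x_1',x_1,x_2',x_2,w$ with $x_1'\ll x_1\leq w$ and $x_2'\ll x_2\leq w$ there is $x$ with $x_1',x_2'\ll x$ and $x\leq w$, $x\leq x_1+x_2$. An ideal of $S$ is a submonoid $I\subseteq S$ closed under suprema of increasing sequences and downward hereditary ($x\leq y\in I$ implies $x\in I$). Write $x\leq_I y$ if $x\leq y+w$ for some $w\in I$, and $x\sim_I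 y$ if $x\leq_I y$ and $y\leq_I x$; $S/I$ is the set of $\sim_I$-classes with the induced addition and order, which is a $\mathrm{Cu}$-semigroup. An ideal is a $\mathrm{Cu}$-semigroup with the induced structure. Write $x<_s y$ if $(n+1)x\leq ny$ for some $n\in\mathbb{N}$ ($\mathbb{N}$ includes $0$). $S$ has $m$-comparison if whenever $x,y_0,\ldots,y_m\in S$ satisfy $x<_s y_j$ for $j=0,\ldots,m$, then $x\leq y_0+\ldots+y_m$. *)

theory Defs
  imports "HOL-Algebra.FiniteProduct"
begin

text \<open>
  Ordered monoids are records over the monoids of HOL-Algebra, whose notation is multiplicative.
  The semigroups here are usually written additively, so \<open>x \<otimes> y\<close> is the sum \<open>x + y\<close>, \<open>\<one>\<close> is \<open>0\<close>,
  \<open>x [^] n\<close> (with \<open>n :: nat\<close>) is the multiple \<open>n x\<close>, and \<open>\<Otimes>j\<in>{..m}. y j\<close> is \<open>y\<^sub>0 + ... + y\<^sub>m\<close>.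
\<close>

record 'a ordered_monoid = "'a monoid" +
  ole :: "['a, 'a] \<Rightarrow> bool" (infixl \<open>\<preceq>\<index>\<close> 50)

abbreviation order_of :: "('a, 'b) ordered_monoid_scheme \<Rightarrow> 'a gorder" where
  "order_of S \<equiv> \<lparr>carrier = carrier S, eq = (=), le = ole S\<rparr>"

locale positively_ordered_monoid =
  comm_monoid S + order: partial_order "order_of S" for S (structure) +
  assumes add_mono:
      "\<lbrakk>x \<preceq> y; z \<preceq> w; x \<in> carrier S; y \<in> carrier S; z \<in> carrier S; w \<in> carrier S\<rbrakk>
        \<Longrightarrow> x \<otimes> z \<preceq> y \<otimes> w"
    and zero_le: "x \<in> carrier S \<Longrightarrow> \<one> \<preceq> x"

definition increasing :: "('a, 'b) ordered_monoid_scheme \<Rightarrow> (nat \<Rightarrow> 'a) \<Rightarrow> bool" where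
  "increasing S X \<longleftrightarrow> (\<forall>n. X n \<in> carrier S) \<and> (\<forall>n. X n \<preceq>\<^bsub>S\<^esub> X (Suc n))"

definition is_sup :: "('a, 'b) ordered_monoid_scheme \<Rightarrow> (nat \<Rightarrow> 'a) \<Rightarrow> 'a \<Rightarrow> bool" where
  "is_sup S X s \<longleftrightarrow> is_lub (order_of S) s (range X)"

definition way_below :: "('a, 'b) ordered_monoid_scheme \<Rightarrow> 'a \<Rightarrow> 'a \<Rightarrow> bool"
    (infixl \<open>\<lless>\<index>\<close> 50) where
  "x \<lless>\<^bsub>S\<^esub> y \<longleftrightarrow> x \<in> carrier S \<and> y \<in> carrier S \<and>
    (\<forall>Y s. increasing S Y \<and> is_sup S Y s \<and> y \<preceq>\<^bsub>S\<^esub> s \<longrightarrow> (\<exists>n. x \<preceq>\<^bsub>S\<^esub> Y n))"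

locale cu_semigroup = positively_ordered_monoid S for S (structure) +
  assumes O1: "increasing S X \<Longrightarrow> \<exists>s. is_sup S X s"
    and O2: "x \<in> carrier S \<Longrightarrow> \<exists>X. (\<forall>n. X n \<lless> X (Suc n)) \<and> is_sup S X x"
    and O3: "\<lbrakk>x' \<lless> x; y' \<lless> y\<rbrakk> \<Longrightarrow> x' \<otimes> y' \<lless> x \<otimes> y"
    and O4: "\<lbrakk>increasing S X; increasing S Y; is_sup S X s; is_sup S Y t\<rbrakk>
        \<Longrightarrow> is_sup S (\<lambda>n. X n \<otimes> Y n) (s \<otimes> t)"

definition axiom_O5 :: "('a, 'b) ordered_monoid_scheme \<Rightarrow> bool" where
  "axiom_O5 S \<longleftrightarrow>
    (\<forall>r'\<in>carrier S. \<forall>r\<in>carrier S. \<forall>s'\<in>carrier S. \<forall>s\<in>carrier S. \<forall>t\<in>carrier S.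
      r \<otimes>\<^bsub>S\<^esub> s \<preceq>\<^bsub>S\<^esub> t \<and> r' \<lless>\<^bsub>S\<^esub> r \<and> s' \<lless>\<^bsub>S\<^esub> s \<longrightarrow>
      (\<exists>u\<in>carrier S. r' \<otimes>\<^bsub>S\<^esub> u \<preceq>\<^bsub>S\<^esub> t \<and> t \<preceq>\<^bsub>S\<^esub> r \<otimes>\<^bsub>S\<^esub> u \<and> s' \<lless>\<^bsub>S\<^esub> u))"

definition axiom_O6 :: "('a, 'b) ordered_monoid_scheme \<Rightarrow> bool" where
  "axiom_O6 S \<longleftrightarrow>
    (\<forall>x'\<in>carrier S. \<forall>x\<in>carrier S. \<forall>y\<in>carrier S. \<forall>z\<in>carrier S.
      x' \<lless>\<^bsub>S\<^esub> x \<and> x \<preceq>\<^bsub>S\<^esub> y \<otimes>\<^bsub>S\<^esub> z \<longrightarrow>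
      (\<exists>e\<in>carrier S. \<exists>f\<in>carrier S. x' \<preceq>\<^bsub>S\<^esub> e \<otimes>\<^bsub>S\<^esub> f \<and>
        e \<preceq>\<^bsub>S\<^esub> x \<and> e \<preceq>\<^bsub>S\<^esub> y \<and> f \<preceq>\<^bsub>S\<^esub> x \<and> f \<preceq>\<^bsub>S\<^esub> z))"

definition axiom_O7 :: "('a, 'b) ordered_monoid_scheme \<Rightarrow> bool" where
  "axiom_O7 S \<longleftrightarrow>
    (\<forall>x\<^sub>1'\<in>carrier S. \<forall>x\<^sub>1\<in>carrier S. \<forall>x\<^sub>2'\<in>carrier S. \<forall>x\<^sub>2\<in>carrier S. \<forall>w\<in>carrier S.
      x\<^sub>1' \<lless>\<^bsub>S\<^esub> x\<^sub>1 \<and> x\<^sub>1 \<preceq>\<^bsub>S\<^esub> w \<and> x\<^sub>2' \<lless>\<^bsub>S\<^esub> x\<^sub>2 \<and> x\<^sub>2 \<preceq>\<^bsub>S\<^esub> w \<longrightarrow>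
      (\<exists>x\<in>carrier S. x\<^sub>1' \<lless>\<^bsub>S\<^esub> x \<and> x\<^sub>2' \<lless>\<^bsub>S\<^esub> x \<and> x \<preceq>\<^bsub>S\<^esub> w \<and> x \<preceq>\<^bsub>S\<^esub> x\<^sub>1 \<otimes>\<^bsub>S\<^esub> x\<^sub>2))"

locale cu_ideal = submonoid I S for I and S (structure) +
  assumes sup_closed: "\<lbrakk>increasing S X; \<And>n. X n \<in> I; is_sup S X s\<rbrakk> \<Longrightarrow> s \<in> I"
    and hereditary: "\<lbrakk>x \<in> carrier S; y \<in> I; x \<preceq> y\<rbrakk> \<Longrightarrow> x \<in> I"

definition le_mod :: "('a, 'b) ordered_monoid_scheme \<Rightarrow> 'a set \<Rightarrow> 'a \<Rightarrow> 'a \<Rightarrow> bool" where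
  "le_mod S I x y \<longleftrightarrow> (\<exists>w\<in>I. x \<preceq>\<^bsub>S\<^esub> y \<otimes>\<^bsub>S\<^esub> w)"

definition eq_mod :: "('a, 'b) ordered_monoid_scheme \<Rightarrow> 'a set \<Rightarrow> ('a \<times> 'a) set" where
  "eq_mod S I =
    {(x, y). x \<in> carrier S \<and> y \<in> carrier S \<and> le_mod S I x y \<and> le_mod S I y x}"

text \<open>
  The sum and the order of classes are written without choosing representatives;
  \<open>quotient_add\<close> and \<open>quotient_le\<close> below say that they are the induced ones.
\<close>

definition cu_quotient :: "('a, 'b) ordered_monoid_scheme \<Rightarrow> 'a set \<Rightarrow> 'a set ordered_monoid" where
  "cu_quotient S I =
    \<lparr>carrier = carrier S // eq_mod S I,
     mult = (\<lambda>X Y. \<Union>x\<in>X. \<Union>y\<in>Y. eq_mod S I `` {x \<otimes>\<^bsub>S\<^esub> y}),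
     one = eq_mod S I `` {\<one>\<^bsub>S\<^esub>},
     ole = (\<lambda>X Y. \<exists>x\<in>X. \<exists>y\<in>Y. le_mod S I x y)\<rparr>"

definition stably_less :: "('a, 'b) ordered_monoid_scheme \<Rightarrow> 'a \<Rightarrow> 'a \<Rightarrow> bool" where
  "stably_less S x y \<longleftrightarrow> (\<exists>n::nat. x [^]\<^bsub>S\<^esub> (n + 1) \<preceq>\<^bsub>S\<^esub> y [^]\<^bsub>S\<^esub> n)"

definition has_comparison :: "nat \<Rightarrow> ('a, 'b) ordered_monoid_scheme \<Rightarrow> bool" where
  "has_comparison m S \<longleftrightarrow>
    (\<forall>x\<in>carrier S. \<forall>y\<in>{..m} \<rightarrow> carrier S.
      (\<forall>j\<le>m. stably_less S x (y j)) \<longrightarrow> x \<preceq>\<^bsub>S\<^esub> (\<Otimes>\<^bsub>S\<^esub>j\<in>{..m}. y j))"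

context
  fixes S :: "('a, 'b) ordered_monoid_scheme" (structure) and I :: "'a set"
  assumes S: "positively_ordered_monoid S" and I: "cu_ideal I S"
begin

interpretation positively_ordered_monoid S by (rule S)
interpretation cu_ideal I S by (rule I)

lemma le_mod_trans:
  assumes "le_mod S I x y" "le_mod S I y z" "x \<in> carrier S" "y \<in> carrier S" "z \<in> carrier S"
  shows "le_mod S I x z"
proof -
  obtain v w where v: "v \<in> I" "x \<preceq> y \<otimes> v" and w: "w \<in> I" "y \<preceq> z \<otimes> w"
    using assms unfolding le_mod_def by blast
  have c: "v \<in> carrier S" "w \<in> carrier S" using v w subset by auto
  have "y \<otimes> v \<preceq> (z \<otimes> w) \<otimes> v"
    using add_mono[OF w(2), of v v] order.le_refl[of v] c assms by simp
  also have "(z \<otimes> w) \<otimes> v = z \<otimes> (w \<otimes> v)" using c assms by (simp add: m_assoc)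
  finally have "x \<preceq> z \<otimes> (w \<otimes> v)"
    using order.le_trans[of x "y \<otimes> v" "z \<otimes> (w \<otimes> v)"] v c assms by simp
  then show ?thesis using v w unfolding le_mod_def by blast
qed

lemma le_mod_refl: "x \<in> carrier S \<Longrightarrow> le_mod S I x x"
  unfolding le_mod_def using order.le_refl[of x] by (intro bexI[of _ \<one>]) auto

lemma le_mod_add:
  assumes "le_mod S I x y" "le_mod S I x' y'"
    "x \<in> carrier S" "y \<in> carrier S" "x' \<in> carrier S" "y' \<in> carrier S"
  shows "le_mod S I (x \<otimes> x') (y \<otimes> y')"
proof -
  obtain v w where v: "v \<in> I" "x \<preceq> y \<otimes> v" and w: "w \<in> I" "x' \<preceq> y' \<otimes> w"
    using assms unfolding le_mod_def by blast
  have c: "v \<in> carrier S" "w \<in> carrier S" using v w subset by auto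
  have "x \<otimes> x' \<preceq> (y \<otimes> v) \<otimes> (y' \<otimes> w)" using v w c assms by (intro add_mono) auto
  also have "(y \<otimes> v) \<otimes> (y' \<otimes> w) = (y \<otimes> y') \<otimes> (v \<otimes> w)" using c assms by (simp add: m_ac)
  finally show ?thesis using v w unfolding le_mod_def by blast
qed

lemma equiv_eq_mod: "equiv (carrier S) (eq_mod S I)"
  by (rule equivI) (auto simp: eq_mod_def refl_on_def sym_def trans_def
      intro: le_mod_refl le_mod_trans)

lemma quotient_add:
  assumes "x \<in> carrier S" "y \<in> carrier S"
  shows "eq_mod S I `` {x} \<otimes>\<^bsub>cu_quotient S I\<^esub> eq_mod S I `` {y} = eq_mod S I `` {x \<otimes> y}"
proof -
  have "eq_mod S I `` {a \<otimes> b} = eq_mod S I `` {x \<otimes> y}"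
    if "a \<in> eq_mod S I `` {x}" "b \<in> eq_mod S I `` {y}" for a b
    using that by (intro equiv_class_eq[OF equiv_eq_mod]) (auto simp: eq_mod_def intro: le_mod_add)
  moreover have "x \<in> eq_mod S I `` {x}" "y \<in> eq_mod S I `` {y}"
    using assms by (auto simp: eq_mod_def le_mod_refl)
  ultimately have "(\<Union>a\<in>eq_mod S I `` {x}. \<Union>b\<in>eq_mod S I `` {y}. eq_mod S I `` {a \<otimes> b})
      = (\<Union>a\<in>eq_mod S I `` {x}. \<Union>b\<in>eq_mod S I `` {y}. eq_mod S I `` {x \<otimes> y})"
    by (intro SUP_cong refl)
  also have "\<dots> = eq_mod S I `` {x \<otimes> y}"
    using \<open>x \<in> eq_mod S I `` {x}\<close> \<open>y \<in> eq_mod S I `` {y}\<close> by (simp only: UN_constant) auto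
  finally show ?thesis by (simp add: cu_quotient_def)
qed

lemma quotient_le:
  assumes "x \<in> carrier S" "y \<in> carrier S"
  shows "eq_mod S I `` {x} \<preceq>\<^bsub>cu_quotient S I\<^esub> eq_mod S I `` {y} \<longleftrightarrow> le_mod S I x y"
proof
  assume "eq_mod S I `` {x} \<preceq>\<^bsub>cu_quotient S I\<^esub> eq_mod S I `` {y}"
  then obtain a b where "(x, a) \<in> eq_mod S I" "(y, b) \<in> eq_mod S I" "le_mod S I a b"
    unfolding cu_quotient_def by auto
  then show "le_mod S I x y" unfolding eq_mod_def by (auto intro: le_mod_trans)
next
  assume "le_mod S I x y"
  moreover have "x \<in> eq_mod S I `` {x}" "y \<in> eq_mod S I `` {y}"
    using assms by (auto simp: eq_mod_def le_mod_refl)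
  ultimately show "eq_mod S I `` {x} \<preceq>\<^bsub>cu_quotient S I\<^esub> eq_mod S I `` {y}"
    unfolding cu_quotient_def by auto
qed

end

end

theory Submission
  imports Defs
begin

text \<open>
  Let \<open>x\<close> be stably below each of \<open>y\<^sub>0, ..., y\<^sub>m\<close>, where \<open>m = m\<^sub>1 + m\<^sub>2 + 1\<close>. The first \<open>m\<^sub>1 + 1\<close>
  elements serve the quotient and the other \<open>m\<^sub>2 + 1\<close> serve the ideal. Comparison in \<open>S/I\<close> gives
  \<open>x \<preceq> (y\<^sub>0 + ... + y\<^bsub>m\<^sub>1\<^esub>) + w\<close> with \<open>w \<in> I\<close>, and (O6) splits this: an element way below \<open>x\<close> is
  dominated by \<open>e + f'\<close>, where \<open>e \<preceq> y\<^sub>0 + ... + y\<^bsub>m\<^sub>1\<^esub>\<close> and \<open>f' \<lless> f\<close> for some \<open>f \<preceq> x\<close> that lies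
  below \<open>w\<close>, hence in \<open>I\<close>. It remains to absorb \<open>f'\<close> into the other \<open>y\<^sub>j\<close>.

  Since \<open>f \<preceq> x\<close>, the element \<open>f\<close> is stably below them, but they need not lie in \<open>I\<close>, so
  comparison in \<open>I\<close> does not apply yet. The heart of the proof is \<open>multiple_le_refine\<close>: an
  inequality \<open>a \<preceq> n y\<close> is, up to replacing \<open>a\<close> by an element way below it, witnessed by some
  \<open>z \<preceq> y\<close> that is itself dominated by a multiple of \<open>a\<close>. For \<open>a = (n + 1) f\<close> such a \<open>z\<close> lies in
  \<open>I\<close>. So \<open>f'\<close> is stably below elements \<open>z\<^sub>j \<preceq> y\<^sub>j\<close> of \<open>I\<close>
  (\<open>stably_less_ideal_witness\<close>), and comparison in \<open>I\<close> yields \<open>f' \<preceq> \<Sum> z\<^sub>j \<preceq> \<Sum> y\<^sub>j\<close>.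
  As \<open>x\<close> is the supremum of elements way below it, the bound passes to \<open>x\<close>.
\<close>

section \<open>Multiples and sums in a positively ordered monoid\<close>

context positively_ordered_monoid
begin

lemma le_trans:
  "\<lbrakk>x \<preceq> y; y \<preceq> z; x \<in> carrier S; y \<in> carrier S; z \<in> carrier S\<rbrakk> \<Longrightarrow> x \<preceq> z"
  using order.le_trans[of x y z] by simp

lemma le_refl: "x \<in> carrier S \<Longrightarrow> x \<preceq> x"
  using order.le_refl[of x] by simp

lemma nat_pow_mono:
  assumes "x \<preceq> y" "x \<in> carrier S" "y \<in> carrier S"
  shows "x [^] (n::nat) \<preceq> y [^] n"
  by (induction n) (use assms in \<open>auto intro: add_mono le_refl\<close>)

lemma finprod_mono:
  assumes "f \<in> {..n::nat} \<rightarrow> carrier S" "g \<in> {..n} \<rightarrow> carrier S" "\<And>j. j \<le> n \<Longrightarrow> f j \<preceq> g j"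
  shows "finprod S f {..n} \<preceq> finprod S g {..n}"
  using assms
proof (induction n)
  case (Suc n)
  then have "f \<in> {..n} \<rightarrow> carrier S" "g \<in> {..n} \<rightarrow> carrier S" by auto
  moreover from this have "finprod S f {..n} \<preceq> finprod S g {..n}" using Suc by auto
  ultimately show ?case
    using Suc.prems by (subst (1 2) finprod_Suc) (auto intro!: add_mono)
qed auto

lemma finprod_append:
  assumes "f \<in> {..m + n + (1::nat)} \<rightarrow> carrier S"
  shows "finprod S f {..m + n + 1} = finprod S f {..m} \<otimes> finprod S (\<lambda>j. f (m + 1 + j)) {..n}"
  using assms
proof (induction n)
  case 0
  then have *: "f \<in> {..Suc m} \<rightarrow> carrier S" "f \<in> {..m} \<rightarrow> carrier S" "f (Suc m) \<in> carrier S"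
    by auto
  then show ?case using finprod_Suc[OF *(1)] finprod_closed[OF *(2)] by (simp add: m_comm)
next
  case (Suc n)
  then have *: "f \<in> {..Suc (m + n + 1)} \<rightarrow> carrier S" "f \<in> {..m + n + 1} \<rightarrow> carrier S"
    "f \<in> {..m} \<rightarrow> carrier S" "(\<lambda>j. f (m + 1 + j)) \<in> {..Suc n} \<rightarrow> carrier S"
    "(\<lambda>j. f (m + 1 + j)) \<in> {..n} \<rightarrow> carrier S" by auto
  then have "finprod S f {..Suc (m + n + 1)}
      = f (m + 1 + Suc n) \<otimes> (finprod S f {..m} \<otimes> finprod S (\<lambda>j. f (m + 1 + j)) {..n})"
    using finprod_Suc[OF *(1)] Suc.IH by simp
  also have "\<dots> = finprod S f {..m} \<otimes> finprod S (\<lambda>j. f (m + 1 + j)) {..Suc n}"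
    using finprod_Suc[OF *(4)] finprod_closed[OF *(3)] finprod_closed[OF *(5)] *(1)
    by (simp add: m_lcomm Pi_iff)
  finally show ?case by simp
qed

end

section \<open>The way-below relation\<close>

context cu_semigroup
begin

lemma is_supD:
  assumes "is_sup S X s"
  shows "s \<in> carrier S" and "(\<And>n. X n \<in> carrier S) \<Longrightarrow> X n \<preceq> s"
    and "\<lbrakk>u \<in> carrier S; \<And>n. X n \<preceq> u\<rbrakk> \<Longrightarrow> s \<preceq> u"
  using assms unfolding is_sup_def least_def Upper_def by auto

lemma way_below_carrier: "x \<lless> y \<Longrightarrow> x \<in> carrier S" "x \<lless> y \<Longrightarrow> y \<in> carrier S"
  unfolding way_below_def by auto

lemma way_belowD:
  "\<lbrakk>x \<lless> y; increasing S Y; is_sup S Y s; y \<preceq> s\<rbrakk> \<Longrightarrow> \<exists>n. x \<preceq> Y n"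
  unfolding way_below_def by blast

lemma way_below_imp_le:
  assumes "x \<lless> y"
  shows "x \<preceq> y"
proof -
  have "is_sup S (\<lambda>n. y) y" "increasing S (\<lambda>n. y)"
    using way_below_carrier[OF assms] le_refl
    unfolding is_sup_def least_def Upper_def increasing_def by auto
  then show ?thesis using way_belowD[OF assms _ _ le_refl[OF way_below_carrier(2)[OF assms]]] by blast
qed

lemma zero_way_below: "x \<in> carrier S \<Longrightarrow> \<one> \<lless> x"
  unfolding way_below_def increasing_def using zero_le by blast

lemma le_way_below_trans:
  assumes "x \<preceq> y" "y \<lless> z" "x \<in> carrier S"
  shows "x \<lless> z"
proof -
  have "\<exists>n. x \<preceq> Y n" if Y: "increasing S Y" "is_sup S Y s" "z \<preceq> s" for Y s
  proof -
    obtain n where "y \<preceq> Y n" using way_belowD[OF assms(2) Y] by blast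
    moreover have "Y n \<in> carrier S" using Y(1) unfolding increasing_def by blast
    ultimately show ?thesis using le_trans[OF assms(1)] assms(3) way_below_carrier[OF assms(2)] by blast
  qed
  then show ?thesis using assms way_below_carrier[OF assms(2)] unfolding way_below_def by blast
qed

lemma way_below_sequence:
  assumes "x \<in> carrier S"
  shows "\<exists>X. increasing S X \<and> is_sup S X x \<and> (\<forall>n. X n \<lless> X (Suc n)) \<and> (\<forall>n. X n \<lless> x)"
proof -
  obtain X where X: "\<And>n. X n \<lless> X (Suc n)" "is_sup S X x" using O2[OF assms] by blast
  have c: "X n \<in> carrier S" for n using X(1) way_below_carrier by blast
  then have inc: "increasing S X" using X(1) way_below_imp_le unfolding increasing_def by blast
  have "X n \<lless> x" for n
  proof -
    have "\<exists>k. X n \<preceq> Y k" if Y: "increasing S Y" "is_sup S Y s" "x \<preceq> s" for Y s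
    proof -
      have "X (Suc n) \<preceq> s"
        using le_trans[OF is_supD(2)[OF X(2) c] Y(3) c assms is_supD(1)[OF Y(2)]] .
      then show ?thesis using way_belowD[OF X(1) Y(1,2)] by blast
    qed
    then show ?thesis using c assms unfolding way_below_def by blast
  qed
  then show ?thesis using inc X by blast
qed

lemma way_below_interpolate:
  assumes "x \<lless> z"
  obtains y where "x \<lless> y" "y \<lless> z"
proof -
  have z: "z \<in> carrier S" using assms way_below_carrier by blast
  obtain Z where Z: "increasing S Z" "is_sup S Z z"
      "\<And>n. Z n \<lless> Z (Suc n)" "\<And>n. Z n \<lless> z"
    using way_below_sequence[OF z] by blast
  obtain n where "x \<preceq> Z n" using way_belowD[OF assms Z(1,2) le_refl[OF z]] by blast
  then have "x \<lless> Z (Suc n)"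
    using le_way_below_trans[OF _ Z(3)] way_below_carrier(1)[OF assms] by blast
  then show ?thesis using that Z(4) by blast
qed

lemma le_if_way_below_le:
  assumes "x \<in> carrier S" "u \<in> carrier S" "\<And>x'. x' \<lless> x \<Longrightarrow> x' \<preceq> u"
  shows "x \<preceq> u"
  using way_below_sequence[OF assms(1)] is_supD(3) assms by metis

text \<open>
  By (O4), approximating both summands from way below approximates the sum.
\<close>

lemma way_below_add_approx:
  assumes "x \<lless> y" "y \<preceq> e \<otimes> f" "e \<in> carrier S" "f \<in> carrier S"
  obtains e' f' where "e' \<lless> e" "f' \<lless> f" "x \<preceq> e' \<otimes> f'"
proof -
  obtain E where E: "increasing S E" "is_sup S E e"
      "\<And>n. E n \<lless> E (Suc n)" "\<And>n. E n \<lless> e"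
    using way_below_sequence[OF assms(3)] by blast
  obtain F where F: "increasing S F" "is_sup S F f"
      "\<And>n. F n \<lless> F (Suc n)" "\<And>n. F n \<lless> f"
    using way_below_sequence[OF assms(4)] by blast
  have "increasing S (\<lambda>n. E n \<otimes> F n)"
    using E(1) F(1) unfolding increasing_def by (auto intro: add_mono)
  then obtain n where "x \<preceq> E n \<otimes> F n"
    using way_belowD[OF assms(1) _ O4[OF E(1) F(1) E(2) F(2)] assms(2)] by blast
  then show ?thesis using that E(4) F(4) by blast
qed

lemma way_below_common_interpolant:
  assumes "x \<lless> z" "y \<lless> z"
  obtains z' where "x \<preceq> z'" "y \<preceq> z'" "z' \<lless> z"
proof -
  have cz: "z \<in> carrier S" using assms way_below_carrier by blast
  obtain Z where Z: "increasing S Z" "is_sup S Z z"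
      "\<And>n. Z n \<lless> Z (Suc n)" "\<And>n. Z n \<lless> z"
    using way_below_sequence[OF cz] by blast
  obtain k l where kl: "x \<preceq> Z k" "y \<preceq> Z l"
    using way_belowD[OF assms(1) Z(1,2)] way_belowD[OF assms(2) Z(1,2)] le_refl[OF cz] by blast
  have c: "Z n \<in> carrier S" for n using Z(4) way_below_carrier by blast
  have mono: "Z i \<preceq> Z (i + d)" for i d
  proof (induction d)
    case (Suc d)
    have "Z (i + d) \<preceq> Z (i + Suc d)" using Z(1) by (simp add: increasing_def)
    then show ?case using le_trans[OF Suc.IH] c by blast
  qed (simp add: le_refl c)
  have "x \<preceq> Z (k + l)" "y \<preceq> Z (k + l)"
    using le_trans[OF kl(1) mono[of k l]] le_trans[OF kl(2) mono[of l k]] c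
      way_below_carrier(1)[OF assms(1)] way_below_carrier(1)[OF assms(2)]
    by (simp_all add: add.commute)
  then show ?thesis using that Z(4) by blast
qed

lemma nat_pow_way_below:
  assumes "x \<lless> y"
  shows "x [^] (n::nat) \<lless> y [^] n"
  by (induction n) (auto intro: O3 assms zero_way_below)

section \<open>Refining an inequality with a multiple\<close>

text \<open>
  Iterating (O6), the element \<open>a'\<close> is dominated by a sum of \<open>n\<close> pieces, each of them below both
  \<open>a\<close> and \<open>y\<close>; by (O7) the pieces have a common upper bound \<open>z \<preceq> y\<close> that does not exceed their
  sum. As (O7) bounds only elements way below the given ones, the induction carries along some
  \<open>z' \<lless> z\<close> that already witnesses the inequality.
\<close>

lemma multiple_le_refine:
  assumes O6: "axiom_O6 S" and O7: "axiom_O7 S"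
  shows "\<lbrakk>a' \<lless> a; a \<preceq> y [^] (n::nat); y \<in> carrier S\<rbrakk>
    \<Longrightarrow> \<exists>z' z. z' \<lless> z \<and> z \<preceq> y \<and> z \<preceq> a [^] n \<and> a' \<preceq> z' [^] n"
proof (induction n arbitrary: a a')
  case 0
  have "a' \<preceq> \<one>"
    using 0 way_below_imp_le[OF 0(1)] way_below_carrier[OF 0(1)] le_trans[of a' a \<one>] by simp
  then show ?case
    using 0 zero_le zero_way_below[of \<one>] by (intro exI[of _ \<one>]) simp
next
  case (Suc n)
  note c = way_below_carrier[OF Suc.prems(1)] \<open>y \<in> carrier S\<close>
  \<comment> \<open>Decomposing \<open>d\<close> rather than \<open>a'\<close> leaves room to replace both pieces by elements way below them.\<close>
  obtain d where d: "a' \<lless> d" "d \<lless> a"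
    using way_below_interpolate[OF Suc.prems(1)] by blast
  obtain e f where ef: "e \<in> carrier S" "f \<in> carrier S" "d \<preceq> e \<otimes> f"
      "e \<preceq> a" "e \<preceq> y [^] n" "f \<preceq> a" "f \<preceq> y"
    using O6 d(2) Suc.prems(2) c way_below_carrier(1)[OF d(2)]
    unfolding axiom_O6_def by (metis nat_pow_Suc nat_pow_closed)
  obtain e' f' where ef': "e' \<lless> e" "f' \<lless> f" "a' \<preceq> e' \<otimes> f'"
    using way_below_add_approx[OF d(1) ef(3,1,2)] by blast
  obtain z\<^sub>1' z\<^sub>1 where z1: "z\<^sub>1' \<lless> z\<^sub>1" "z\<^sub>1 \<preceq> y" "z\<^sub>1 \<preceq> e [^] n" "e' \<preceq> z\<^sub>1' [^] n"
    using Suc.IH[OF ef'(1) ef(5) c(3)] by blast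
  note c1 = way_below_carrier[OF z1(1)] way_below_carrier[OF ef'(1)] way_below_carrier[OF ef'(2)]
  obtain z where z: "z\<^sub>1' \<lless> z" "f' \<lless> z" "z \<preceq> y" "z \<preceq> z\<^sub>1 \<otimes> f"
    using O7 z1(1,2) ef'(2) ef(7) c c1 unfolding axiom_O7_def by metis
  obtain z' where z': "z\<^sub>1' \<preceq> z'" "f' \<preceq> z'" "z' \<lless> z"
    using way_below_common_interpolant[OF z(1,2)] by blast
  note c2 = way_below_carrier[OF z'(3)]
  have "z\<^sub>1 \<preceq> a [^] n"
    using z1(3) nat_pow_mono[OF ef(4,1) c(2)] c1 c by (blast intro: le_trans nat_pow_closed)
  then have "z\<^sub>1 \<otimes> f \<preceq> a [^] Suc n" using ef(6) c c1 by (auto intro: add_mono)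
  then have "z \<preceq> a [^] Suc n" using z(4) c c1 c2 by (blast intro: le_trans nat_pow_closed m_closed)
  moreover have "e' \<preceq> z' [^] n"
    using z1(4) nat_pow_mono[OF z'(1)] c1 c2 by (blast intro: le_trans nat_pow_closed)
  then have "e' \<otimes> f' \<preceq> z' [^] Suc n" using z'(2) c1 c2 by (auto intro: add_mono)
  then have "a' \<preceq> z' [^] Suc n"
    using ef'(3) c c1 c2 by (blast intro: le_trans nat_pow_closed m_closed)
  ultimately show ?case using z(3) z'(3) by blast
qed

text \<open>
  The witness lies in \<open>I\<close> because it is dominated by a multiple of \<open>f\<close>; this is what allows
  comparison in \<open>I\<close> to be used against an element \<open>y\<close> outside of \<open>I\<close>.
\<close>

lemma stably_less_ideal_witness:
  assumes O6: "axiom_O6 S" and O7: "axiom_O7 S" and ideal: "cu_ideal I S"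
    and f: "f' \<lless> f" "f \<in> I" and y: "stably_less S f y" "y \<in> carrier S"
  obtains z where "z \<in> I" "z \<preceq> y" "stably_less S f' z"
proof -
  interpret ideal: cu_ideal I S by (rule ideal)
  obtain n :: nat where n: "f [^] (n + 1) \<preceq> y [^] n" using y(1) unfolding stably_less_def by blast
  have pow: "f [^] k \<in> I" for k :: nat by (induction k) (use f in auto)
  have pow': "(f [^] (n + 1)) [^] k \<in> I" for k :: nat
    by (induction k) (use pow[of "n + 1"] in auto)
  obtain z' z where z: "z' \<lless> z" "z \<preceq> y" "z \<preceq> (f [^] (n + 1)) [^] n"
      "f' [^] (n + 1) \<preceq> z' [^] n"
    using multiple_le_refine[OF O6 O7 nat_pow_way_below[OF f(1)] n y(2)] by blast
  note c = way_below_carrier[OF z(1)] y(2)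
  have "z' \<preceq> y" using way_below_imp_le[OF z(1)] z(2) c by (blast intro: le_trans)
  moreover have "z \<in> I" using ideal.hereditary[OF c(2) pow' z(3)] .
  then have "z' \<in> I" using ideal.hereditary[OF c(1)] way_below_imp_le[OF z(1)] by blast
  ultimately show ?thesis using that z(4) unfolding stably_less_def by blast
qed

end

section \<open>Comparison in the quotient and in the ideal, seen in the semigroup\<close>

context
  fixes S :: "('a, 'b) ordered_monoid_scheme" (structure) and I :: "'a set"
  assumes S: "positively_ordered_monoid S" and I: "cu_ideal I S"
begin

interpretation positively_ordered_monoid S by (rule S)
interpretation cu_ideal I S by (rule I)

lemma comm_monoid_quotient: "comm_monoid (cu_quotient S I)"
proof -
  let ?Q = "cu_quotient S I" and ?c = "\<lambda>x. eq_mod S I `` {x}"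
  have car: "carrier ?Q = carrier S // eq_mod S I" and one: "\<one>\<^bsub>?Q\<^esub> = ?c \<one>"
    by (simp_all add: cu_quotient_def)
  have rep: "\<exists>x\<in>carrier S. X = ?c x" if "X \<in> carrier ?Q" for X
    using that unfolding car by (auto elim: quotientE)
  have cl: "?c x \<in> carrier ?Q" if "x \<in> carrier S" for x
    using that unfolding car by (rule quotientI)
  note add = quotient_add[OF S I]
  show ?thesis
  proof (rule comm_monoidI)
    show "X \<otimes>\<^bsub>?Q\<^esub> Y \<in> carrier ?Q" if "X \<in> carrier ?Q" "Y \<in> carrier ?Q" for X Y
      using rep[OF that(1)] rep[OF that(2)] by (auto simp: add cl)
    show "\<one>\<^bsub>?Q\<^esub> \<in> carrier ?Q" by (simp add: one cl)
    show "(X \<otimes>\<^bsub>?Q\<^esub> Y) \<otimes>\<^bsub>?Q\<^esub> Z = X \<otimes>\<^bsub>?Q\<^esub> (Y \<otimes>\<^bsub>?Q\<^esub> Z)"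
      if "X \<in> carrier ?Q" "Y \<in> carrier ?Q" "Z \<in> carrier ?Q" for X Y Z
      using rep[OF that(1)] rep[OF that(2)] rep[OF that(3)] by (auto simp: add m_assoc)
    show "\<one>\<^bsub>?Q\<^esub> \<otimes>\<^bsub>?Q\<^esub> X = X" if "X \<in> carrier ?Q" for X
      using rep[OF that] by (auto simp: add one)
    show "X \<otimes>\<^bsub>?Q\<^esub> Y = Y \<otimes>\<^bsub>?Q\<^esub> X" if "X \<in> carrier ?Q" "Y \<in> carrier ?Q" for X Y
      using rep[OF that(1)] rep[OF that(2)] by (auto simp: add m_comm)
  qed
qed

lemma quotient_class_carrier: "x \<in> carrier S \<Longrightarrow> eq_mod S I `` {x} \<in> carrier (cu_quotient S I)"
  by (simp add: cu_quotient_def quotientI)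

lemma quotient_nat_pow:
  "x \<in> carrier S \<Longrightarrow> eq_mod S I `` {x} [^]\<^bsub>cu_quotient S I\<^esub> (n::nat) = eq_mod S I `` {x [^] n}"
proof (induction n)
  case 0
  then show ?case by (simp add: nat_pow_def cu_quotient_def)
next
  case (Suc n)
  interpret Q: comm_monoid "cu_quotient S I" by (rule comm_monoid_quotient)
  show ?case using Suc by (simp add: quotient_add[OF S I])
qed

lemma quotient_finprod:
  assumes "y \<in> {..n::nat} \<rightarrow> carrier S"
  shows "finprod (cu_quotient S I) (\<lambda>j. eq_mod S I `` {y j}) {..n} = eq_mod S I `` {finprod S y {..n}}"
proof -
  interpret Q: comm_monoid "cu_quotient S I" by (rule comm_monoid_quotient)
  show ?thesis using assms
  proof (induction n)
    case 0
    then show ?case using quotient_class_carrier[of "y 0"] by simp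
  next
    case (Suc n)
    then have y: "y \<in> {..n} \<rightarrow> carrier S" "y (Suc n) \<in> carrier S" by auto
    have "(\<lambda>j. eq_mod S I `` {y j}) \<in> {..Suc n} \<rightarrow> carrier (cu_quotient S I)"
      using Suc.prems by (auto intro: quotient_class_carrier)
    then show ?case
      using Suc.IH[OF y(1)] finprod_Suc[OF Suc.prems] y by (simp add: quotient_add[OF S I] Q.finprod_Suc)
  qed
qed

lemma quotient_comparison:
  assumes "has_comparison m (cu_quotient S I)" "x \<in> carrier S" "y \<in> {..m} \<rightarrow> carrier S"
    "\<And>j. j \<le> m \<Longrightarrow> stably_less S x (y j)"
  shows "le_mod S I x (finprod S y {..m})"
proof -
  let ?Q = "cu_quotient S I" and ?c = "\<lambda>x. eq_mod S I `` {x}"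
  have less: "stably_less ?Q (?c x) (?c (y j))" if j: "j \<le> m" for j
  proof -
    have yj: "y j \<in> carrier S" using assms(3) j by auto
    obtain n :: nat where n: "x [^] (n + 1) \<preceq> y j [^] n"
      using assms(4)[OF j] unfolding stably_less_def by blast
    then have "le_mod S I (x [^] (n + 1)) (y j [^] n)"
      unfolding le_mod_def using yj by (intro bexI[of _ \<one>]) auto
    then have "?c (x [^] (n + 1)) \<preceq>\<^bsub>?Q\<^esub> ?c (y j [^] n)"
      using quotient_le[OF S I] yj assms(2) by (meson nat_pow_closed)
    then show ?thesis
      unfolding stably_less_def using quotient_nat_pow[OF assms(2)] quotient_nat_pow[OF yj] by metis
  qed
  have classes: "(\<lambda>j. ?c (y j)) \<in> {..m} \<rightarrow> carrier ?Q"
    using assms(3) by (auto intro: quotient_class_carrier)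
  have "?c x \<preceq>\<^bsub>?Q\<^esub> finprod ?Q (\<lambda>j. ?c (y j)) {..m}"
    using assms(1)[unfolded has_comparison_def, rule_format,
        OF quotient_class_carrier[OF assms(2)] classes less] .
  then show ?thesis
    using quotient_le[OF S I assms(2)] quotient_finprod[OF assms(3)] finprod_closed[OF assms(3)] by simp
qed

lemma ideal_finprod:
  assumes "z \<in> {..n::nat} \<rightarrow> I"
  shows "finprod (S\<lparr>carrier := I\<rparr>) z {..n} = finprod S z {..n}"
proof -
  interpret I: comm_monoid "S\<lparr>carrier := I\<rparr>" by (rule submonoid_is_comm_monoid) unfold_locales
  show ?thesis using assms
  proof (induction n)
    case 0
    then show ?case using I.finprod_0[of z] finprod_0[of z] subset by auto
  next
    case (Suc n)
    then have "z \<in> {..n} \<rightarrow> I" "z \<in> {..Suc n} \<rightarrow> carrier S" using subset by auto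
    then show ?case using Suc I.finprod_Suc[of z n] finprod_Suc[of z n] by simp
  qed
qed

lemma ideal_comparison:
  assumes "has_comparison m (S\<lparr>carrier := I\<rparr>)" "x \<in> I" "z \<in> {..m} \<rightarrow> I"
    "\<And>j. j \<le> m \<Longrightarrow> stably_less S x (z j)"
  shows "x \<preceq> finprod S z {..m}"
proof -
  have "stably_less (S\<lparr>carrier := I\<rparr>) x (z j)" if "j \<le> m" for j
    using assms(4)[OF that] unfolding stably_less_def nat_pow_def by simp
  then show ?thesis
    using assms(1-3) ideal_finprod[OF assms(3)] unfolding has_comparison_def by fastforce
qed

end

section \<open>Comparison in an extension\<close>

theorem proposition4p5:
  fixes S :: "('a, 'b) ordered_monoid_scheme" and I :: "'a set" and m\<^sub>1 m\<^sub>2 :: nat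
  assumes "cu_semigroup S" and "axiom_O5 S" and "axiom_O6 S" and "axiom_O7 S"
    and "cu_ideal I S"
    and "has_comparison m\<^sub>1 (cu_quotient S I)"
    and "has_comparison m\<^sub>2 (S\<lparr>carrier := I\<rparr>)"
  shows "has_comparison (m\<^sub>1 + m\<^sub>2 + 1) S"
proof -
  interpret cu_semigroup S by (rule assms)
  interpret ideal: cu_ideal I S by (rule assms)
  have pom: "positively_ordered_monoid S" by unfold_locales
  have "x \<preceq>\<^bsub>S\<^esub> finprod S y {..m\<^sub>1 + m\<^sub>2 + 1}"
    if x: "x \<in> carrier S" and y: "y \<in> {..m\<^sub>1 + m\<^sub>2 + 1} \<rightarrow> carrier S"
      and less: "\<And>j. j \<le> m\<^sub>1 + m\<^sub>2 + 1 \<Longrightarrow> stably_less S x (y j)" for x y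
  proof (rule le_if_way_below_le)
    let ?u = "finprod S y {..m\<^sub>1}" and ?v = "finprod S (\<lambda>j. y (m\<^sub>1 + 1 + j)) {..m\<^sub>2}"
    have y1: "y \<in> {..m\<^sub>1} \<rightarrow> carrier S" and y2: "(\<lambda>j. y (m\<^sub>1 + 1 + j)) \<in> {..m\<^sub>2} \<rightarrow> carrier S"
      using y by auto
    have uv: "?u \<in> carrier S" "?v \<in> carrier S" using finprod_closed[OF y1] finprod_closed[OF y2] .
    obtain w where w: "w \<in> I" "x \<preceq>\<^bsub>S\<^esub> ?u \<otimes>\<^bsub>S\<^esub> w"
      using quotient_comparison[OF pom assms(5,6) x y1] less unfolding le_mod_def by auto
    have wc: "w \<in> carrier S" using w(1) ideal.subset by blast
    fix x' assume "x' \<lless>\<^bsub>S\<^esub> x"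
    \<comment> \<open>Decomposing \<open>d\<close> rather than \<open>x'\<close> leaves room to replace both pieces by elements way below them.\<close>
    then obtain d where d: "x' \<lless>\<^bsub>S\<^esub> d" "d \<lless>\<^bsub>S\<^esub> x" using way_below_interpolate by blast
    obtain e f where ef: "e \<in> carrier S" "f \<in> carrier S" "d \<preceq>\<^bsub>S\<^esub> e \<otimes>\<^bsub>S\<^esub> f"
        "e \<preceq>\<^bsub>S\<^esub> ?u" "f \<preceq>\<^bsub>S\<^esub> x" "f \<preceq>\<^bsub>S\<^esub> w"
      using assms(3) d(2) w(2) way_below_carrier[OF d(2)] uv wc unfolding axiom_O6_def by metis
    obtain e' f' where ef': "e' \<lless>\<^bsub>S\<^esub> e" "f' \<lless>\<^bsub>S\<^esub> f" "x' \<preceq>\<^bsub>S\<^esub> e' \<otimes>\<^bsub>S\<^esub> f'"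
      using way_below_add_approx[OF d(1) ef(3,1,2)] by blast
    note c = way_below_carrier[OF ef'(1)] way_below_carrier[OF ef'(2)] way_below_carrier[OF d(1)]
    have fI: "f \<in> I" using ideal.hereditary[OF ef(2) w(1) ef(6)] .
    have f'I: "f' \<in> I" using ideal.hereditary[OF c(3) fI way_below_imp_le[OF ef'(2)]] .
    have "\<exists>z\<in>I. z \<preceq>\<^bsub>S\<^esub> y (m\<^sub>1 + 1 + j) \<and> stably_less S f' z" if j: "j \<le> m\<^sub>2" for j
    proof -
      have yj: "y (m\<^sub>1 + 1 + j) \<in> carrier S" using y2 j by auto
      have "stably_less S x (y (m\<^sub>1 + 1 + j))" using less[of "m\<^sub>1 + 1 + j"] j by simp
      then have "stably_less S f (y (m\<^sub>1 + 1 + j))"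
        unfolding stably_less_def
        using nat_pow_mono[OF ef(5,2) x] ef(2) x yj by (blast intro: le_trans nat_pow_closed)
      then show ?thesis
        using stably_less_ideal_witness[OF assms(3,4,5) ef'(2) fI _ yj] by blast
    qed
    then obtain z where z: "\<And>j. j \<le> m\<^sub>2 \<Longrightarrow> z j \<in> I"
        "\<And>j. j \<le> m\<^sub>2 \<Longrightarrow> z j \<preceq>\<^bsub>S\<^esub> y (m\<^sub>1 + 1 + j)" "\<And>j. j \<le> m\<^sub>2 \<Longrightarrow> stably_less S f' (z j)"
      by metis
    have zI: "z \<in> {..m\<^sub>2} \<rightarrow> I" and zS: "z \<in> {..m\<^sub>2} \<rightarrow> carrier S" using z(1) ideal.subset by auto
    have "f' \<preceq>\<^bsub>S\<^esub> finprod S z {..m\<^sub>2}"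
      using ideal_comparison[OF pom assms(5,7) f'I zI z(3)] .
    then have "f' \<preceq>\<^bsub>S\<^esub> ?v"
      using finprod_mono[OF zS y2 z(2)] finprod_closed[OF zS] c uv by (blast intro: le_trans)
    moreover have "e' \<preceq>\<^bsub>S\<^esub> ?u"
      using way_below_imp_le[OF ef'(1)] ef(4) c uv by (blast intro: le_trans)
    ultimately have "e' \<otimes>\<^bsub>S\<^esub> f' \<preceq>\<^bsub>S\<^esub> ?u \<otimes>\<^bsub>S\<^esub> ?v" using c uv by (auto intro: add_mono)
    then have "x' \<preceq>\<^bsub>S\<^esub> ?u \<otimes>\<^bsub>S\<^esub> ?v" using ef'(3) c uv by (blast intro: le_trans m_closed)
    then show "x' \<preceq>\<^bsub>S\<^esub> finprod S y {..m\<^sub>1 + m\<^sub>2 + 1}" using finprod_append[OF y] by simp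
  qed (use x finprod_closed[OF y] in auto)
  then show ?thesis unfolding has_comparison_def by blast
qed

end
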